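(* For each integer $n\ge 0$, $$\overline{SOME}(4n+3)\equiv 0\pmod 8,$$ $$\overline{SOME}(8n+7)\equiv 0\pmod{64}.$$
   Context: An overpartition of a nonnegative integer $n$ is a partition of $n$ in which the first occurrence of each distinct part may be overlined (or not). For $n\ge 0$, $\overline{SOME}(n)$ denotes the sum, over all overpartitions $\lambda$ of $n$, of (the sum of the odd parts of $\lambda$) minus (the sum of the even parts of $\lambda$), where parts are counted with multiplicity and an overlined part counts with its numerical size. *)

theory Defs
  imports "HOL-Library.Multiset" "HOL-Number_Theory.Cong"
begin

text \<open>
  An overpartition is encoded as a pair \<open>(P, V)\<close>: \<open>P\<close> is the multiset of the numerical sizes of
  its parts, and \<open>V\<close> is the set of those part sizes whose first occurrence is overlined.
\<close>

definition overpartitions :: "nat \<Rightarrow> (nat multiset \<times> nat set) set" where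
  "overpartitions n = {(P, V). 0 \<notin># P \<and> \<Sum>\<^sub># P = n \<and> V \<subseteq> set_mset P}"

definition odd_part_sum :: "nat multiset \<Rightarrow> nat" where
  "odd_part_sum P = \<Sum>\<^sub># (filter_mset odd P)"

definition even_part_sum :: "nat multiset \<Rightarrow> nat" where
  "even_part_sum P = \<Sum>\<^sub># (filter_mset even P)"

definition SOME_bar :: "nat \<Rightarrow> int" where
  "SOME_bar n = (\<Sum>(P, V)\<in>overpartitions n. int (odd_part_sum P) - int (even_part_sum P))"

text \<open>The sum defining \<open>SOME_bar\<close> ranges over a finite set, so it is not a default value.\<close>

lemma size_le_sum_mset:
  fixes P :: "nat multiset"
  shows "0 \<notin># P \<Longrightarrow> size P \<le> \<Sum>\<^sub># P"
  by (induction P) auto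

lemma finite_overpartitions: "finite (overpartitions n)"
proof -
  have "overpartitions n \<subseteq> {P. set_mset P \<subseteq> {..n} \<and> size P \<le> n} \<times> Pow {..n}"
    using size_le_sum_mset by (fastforce simp: overpartitions_def dest: sum_mset.remove)
  moreover have "{P. set_mset P \<subseteq> {..n} \<and> size P \<le> n} \<subseteq> mset ` {xs. set xs \<subseteq> {..n} \<and> length xs \<le> n}"
  proof
    fix P assume P: "P \<in> {P. set_mset P \<subseteq> {..n} \<and> size P \<le> n}"
    obtain xs where "P = mset xs" using ex_mset by metis
    with P show "P \<in> mset ` {xs. set xs \<subseteq> {..n} \<and> length xs \<le> n}" by auto
  qed
  moreover have "finite {xs. set xs \<subseteq> {..n} \<and> length xs \<le> n}"
    by (rule finite_lists_length_le) simp
  ultimately show ?thesis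
    by (meson finite_Pow_iff finite_SigmaI finite_atMost finite_imageI finite_subset)
qed

end

theory Submission
  imports Defs "HOL-Computational_Algebra.Formal_Laurent_Series"
begin

text \<open>
  Let \<open>A(q)\<close> be the generating function of the overpartitions, the product of
  \<open>(1 + q^m) / (1 - q^m)\<close> over all \<open>m > 0\<close>, let \<open>S(q)\<close> be that of \<open>SOME_bar\<close>, and let \<open>\<phi>(q)\<close> be the
  sum of \<open>q^(k^2)\<close> over all integers \<open>k\<close>. The proof expresses \<open>S\<close> through theta series whose
  exponents have few residues modulo 8 and whose coefficients carry the powers of 2.

  The parts of an overpartition contribute additively to the statistic, so \<open>S / A\<close> is a sum over
  \<open>m\<close> of plus or minus \<open>q d/dq\<close> of the logarithm of \<open>(1 + q^m) / (1 - q^m)\<close>. The sign \<open>(-1)^(m+1)\<close>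
  is exactly what the substitution \<open>q \<mapsto> -q\<close> produces up to a global sign, hence
  \<open>S(q) / A(q) = - (q d/dq) log A(-q)\<close> (\<open>SOME_gf_eq_log_derivative\<close>). By Gauss's identity
  \<open>A(q) \<phi>(-q) = 1\<close> (\<open>gauss_identity\<close>) this becomes \<open>S(q) = q \<phi>'(q) A(q) A(-q)\<close>.

  From \<open>\<phi>(q) \<phi>(-q) = \<phi>(-q^2)^2\<close> (\<open>theta_mult_neg_arg_theta\<close>) one gets \<open>A(q) A(-q) = A(q^2)^2\<close> and
  \<open>A(q) = \<phi>(q) A(q^2)^2\<close>. Iterating the latter yields (\<open>SOME_gf_factorization\<close>)
  \<open>S(q) = q \<phi>'(q) \<cdot> \<phi>(q^2)^2 \<cdot> \<phi>(q^4)^4 A(q^8)^8\<close>.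

  The first factor has even coefficients, and its exponents are squares, hence 0, 1 or 4 modulo 8.
  In the second factor the coefficients at exponents congruent to 2 modulo 4 are divisible by 4, and
  they vanish at exponents congruent to 6 modulo 8 since a sum of two squares is never 3 modulo 4. In
  the third factor the exponents are multiples of 4, and the coefficients at exponents congruent to 4
  modulo 8 are divisible by 8. A total exponent congruent to 3 modulo 4 needs exponents 1 and 2 modulo
  4 in the first two factors, which gives \<open>2 \<cdot> 4 = 8\<close>. A total exponent congruent to 7 modulo 8 needs
  exponents 1, 2 and 4 modulo 8 in the three factors, which gives \<open>2 \<cdot> 4 \<cdot> 8 = 64\<close>.
\<close>

section \<open>Generating functions of overpartitions with bounded parts\<close>

definition alternating_part_sum :: "nat multiset \<Rightarrow> int" where
  "alternating_part_sum P = int (odd_part_sum P) - int (even_part_sum P)"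

text \<open>
  The number of sets \<open>V\<close> for which \<open>(P, V)\<close> is an overpartition.
\<close>

definition overlinings :: "nat multiset \<Rightarrow> int" where
  "overlinings P = 2 ^ card (set_mset P)"

definition bounded_partitions :: "nat \<Rightarrow> nat \<Rightarrow> nat multiset set" where
  "bounded_partitions m n = {P. set_mset P \<subseteq> {1..m} \<and> \<Sum>\<^sub># P = n}"

lemma finite_bounded_partitions: "finite (bounded_partitions m n)"
proof (rule finite_subset)
  show "bounded_partitions m n \<subseteq> fst ` overpartitions n"
    by (force simp: bounded_partitions_def overpartitions_def image_iff)
qed (simp add: finite_overpartitions)

lemma overpartitions_eq_Sigma:
  assumes "n \<le> m"
  shows "overpartitions n = (SIGMA P : bounded_partitions m n. Pow (set_mset P))"
proof -
  have "P \<in> bounded_partitions m n \<longleftrightarrow> 0 \<notin># P \<and> \<Sum>\<^sub># P = n" for P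
    using assms
    by (fastforce simp: bounded_partitions_def subset_iff Suc_le_eq intro!: gr0I
          dest: sum_mset.remove)
  thus ?thesis by (auto simp: overpartitions_def)
qed

lemma sum_overpartitions:
  fixes F :: "nat multiset \<Rightarrow> int"
  assumes "n \<le> m"
  shows "(\<Sum>(P, V)\<in>overpartitions n. F P) = (\<Sum>P\<in>bounded_partitions m n. overlinings P * F P)"
proof -
  have "(\<Sum>(P, V)\<in>overpartitions n. F P) =
        (\<Sum>P\<in>bounded_partitions m n. \<Sum>V\<in>Pow (set_mset P). F P)"
    unfolding overpartitions_eq_Sigma[OF assms]
    by (subst sum.Sigma) (auto simp: finite_bounded_partitions)
  thus ?thesis by (simp add: card_Pow overlinings_def)
qed

lemma bounded_partitions_0: "bounded_partitions 0 n = (if n = 0 then {{#}} else {})"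
  by (auto simp: bounded_partitions_def)

text \<open>
  A partition with parts at most \<open>m + 1\<close> is a partition of some \<open>i\<close> with parts at most \<open>m\<close>,
  together with copies of \<open>m + 1\<close> that fill up the remaining \<open>n - i\<close>. Sorting by \<open>i\<close> gives the sum
  the shape of a Cauchy product, whatever statistic \<open>F\<close> is summed.
\<close>

lemma sum_bounded_partitions_Suc:
  fixes F :: "nat multiset \<Rightarrow> int"
  shows "(\<Sum>P\<in>bounded_partitions (Suc m) n. F P) =
    (\<Sum>i=0..n. \<Sum>Q\<in>bounded_partitions m i.
       if Suc m dvd n - i then F (Q + replicate_mset ((n - i) div Suc m) (Suc m)) else 0)"
proof -
  let ?I = "SIGMA i:{i\<in>{0..n}. Suc m dvd n - i}. bounded_partitions m i"
  have rest: "filter_mset (\<lambda>x. x \<noteq> Suc m) Q = Q"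
    if "set_mset Q \<subseteq> {1..m}" for Q :: "nat multiset"
    using that by (subst filter_mset_eq_conv) (auto simp: subset_iff)
  have split: "P = filter_mset (\<lambda>x. x \<noteq> Suc m) P + replicate_mset (count P (Suc m)) (Suc m)"
    for P by (rule multiset_eqI) simp
  have total: "\<Sum>\<^sub># P = \<Sum>\<^sub># (filter_mset (\<lambda>x. x \<noteq> Suc m) P) + count P (Suc m) * Suc m" for P
    by (subst (1) split) (simp only: sum_mset.union sum_mset_replicate_mset of_nat_id)
  have "(\<Sum>P\<in>bounded_partitions (Suc m) n. F P) =
      (\<Sum>(i, Q)\<in>?I. F (Q + replicate_mset ((n - i) div Suc m) (Suc m)))"
  proof (rule sum.reindex_bij_witness[where
        i = "\<lambda>(i, Q). Q + replicate_mset ((n - i) div Suc m) (Suc m)" and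
        j = "\<lambda>P. (\<Sum>\<^sub># (filter_mset (\<lambda>x. x \<noteq> Suc m) P), filter_mset (\<lambda>x. x \<noteq> Suc m) P)"])
    fix P assume P: "P \<in> bounded_partitions (Suc m) n"
    have n: "n - \<Sum>\<^sub># (filter_mset (\<lambda>x. x \<noteq> Suc m) P) = count P (Suc m) * Suc m"
      using P total[of P] unfolding bounded_partitions_def
      by (metis (mono_tags, lifting) diff_add_inverse mem_Collect_eq)
    show *: "(case (\<Sum>\<^sub># (filter_mset (\<lambda>x. x \<noteq> Suc m) P), filter_mset (\<lambda>x. x \<noteq> Suc m) P) of
        (i, Q) \<Rightarrow> Q + replicate_mset ((n - i) div Suc m) (Suc m)) = P"
      unfolding prod.case n nonzero_mult_div_cancel_right[OF Suc_not_Zero]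
      by (rule split[symmetric])
    show "(\<Sum>\<^sub># (filter_mset (\<lambda>x. x \<noteq> Suc m) P), filter_mset (\<lambda>x. x \<noteq> Suc m) P) \<in> ?I"
    proof -
      have "Suc m dvd n - \<Sum>\<^sub># (filter_mset (\<lambda>x. x \<noteq> Suc m) P)"
        unfolding n by (rule dvd_triv_right)
      moreover have "\<Sum>\<^sub># (filter_mset (\<lambda>x. x \<noteq> Suc m) P) \<le> n"
        using P total[of P] by (simp add: bounded_partitions_def)
      ultimately show ?thesis
        using P by (auto simp: bounded_partitions_def subset_iff le_Suc_eq)
    qed
    show "(case (\<Sum>\<^sub># (filter_mset (\<lambda>x. x \<noteq> Suc m) P), filter_mset (\<lambda>x. x \<noteq> Suc m) P) of
        (i, Q) \<Rightarrow> F (Q + replicate_mset ((n - i) div Suc m) (Suc m))) = F P"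
      using * by simp
  next
    fix x assume "x \<in> ?I"
    then obtain i Q where x: "x = (i, Q)" and i: "i \<le> n" "Suc m dvd n - i"
      and Q: "set_mset Q \<subseteq> {1..m}" "\<Sum>\<^sub># Q = i"
      by (auto simp: bounded_partitions_def)
    have [simp]: "filter_mset (\<lambda>x. x \<noteq> Suc m) (replicate_mset c (Suc m)) = {#}" for c
      by (induction c) auto
    show "(case x of (i, Q) \<Rightarrow> Q + replicate_mset ((n - i) div Suc m) (Suc m))
        \<in> bounded_partitions (Suc m) n"
      using i Q by (auto simp: x bounded_partitions_def subset_iff simp del: mult_Suc_right
        split: if_splits)
    show "(\<Sum>\<^sub># (filter_mset (\<lambda>x. x \<noteq> Suc m)
             (case x of (i, Q) \<Rightarrow> Q + replicate_mset ((n - i) div Suc m) (Suc m))),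
           filter_mset (\<lambda>x. x \<noteq> Suc m)
             (case x of (i, Q) \<Rightarrow> Q + replicate_mset ((n - i) div Suc m) (Suc m))) = x"
      using rest[OF Q(1)] Q(2) by (simp add: x)
  qed
  also have "\<dots> = (\<Sum>i\<in>{i\<in>{0..n}. Suc m dvd n - i}. \<Sum>Q\<in>bounded_partitions m i.
      F (Q + replicate_mset ((n - i) div Suc m) (Suc m)))"
    by (subst sum.Sigma) (auto simp: finite_bounded_partitions)
  also have "\<dots> = (\<Sum>i=0..n. if Suc m dvd n - i then \<Sum>Q\<in>bounded_partitions m i.
      F (Q + replicate_mset ((n - i) div Suc m) (Suc m)) else 0)"
    by (rule sum.inter_filter) simp
  also have "\<dots> = (\<Sum>i=0..n. \<Sum>Q\<in>bounded_partitions m i.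
      if Suc m dvd n - i then F (Q + replicate_mset ((n - i) div Suc m) (Suc m)) else 0)"
    by (intro sum.cong) auto
  finally show ?thesis .
qed

definition bounded_gf :: "nat \<Rightarrow> int fps" where
  "bounded_gf m = Abs_fps (\<lambda>n. \<Sum>P\<in>bounded_partitions m n. overlinings P)"

definition bounded_SOME_gf :: "nat \<Rightarrow> int fps" where
  "bounded_SOME_gf m =
    Abs_fps (\<lambda>n. \<Sum>P\<in>bounded_partitions m n. overlinings P * alternating_part_sum P)"

text \<open>
  The overpartitions whose parts all equal \<open>m\<close>: there are two of every positive multiple of \<open>m\<close>,
  so for \<open>m > 0\<close> this is \<open>(1 + q^m) / (1 - q^m)\<close>.
\<close>

definition single_part_gf :: "nat \<Rightarrow> int fps" where
  "single_part_gf m = Abs_fps (\<lambda>n. if m dvd n then if n = 0 then 1 else 2 else 0)"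

text \<open>
  The operator \<open>q d/dq\<close>: on generating functions it multiplies each object by its total size.
\<close>

definition q_deriv :: "int fps \<Rightarrow> int fps" where
  "q_deriv f = fps_X * fps_deriv f"

abbreviation neg_arg :: "int fps \<Rightarrow> int fps" where
  "neg_arg f \<equiv> fps_compose f (- fps_X)"

lemma q_deriv_nth: "q_deriv f $ n = int n * f $ n"
  by (cases n) (auto simp: q_deriv_def)

lemma neg_arg_nth: "neg_arg f $ n = (-1) ^ n * f $ n"
  by (simp add: fps_compose_uminus')

lemma neg_arg_mult: "neg_arg (f * g) = neg_arg f * neg_arg g"
  by (rule fps_compose_mult_distrib) simp

lemma neg_arg_neg_arg: "neg_arg (neg_arg f) = f"
  by (simp add: fps_eq_iff neg_arg_nth flip: mult.assoc power_mult_distrib)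

lemma q_deriv_mult: "q_deriv (f * g) = q_deriv f * g + f * q_deriv g"
  by (simp add: q_deriv_def algebra_simps)

lemma one_minus_X_power_nonzero: "m > 0 \<Longrightarrow> (1 :: int fps) - fps_X ^ m \<noteq> 0"
proof
  assume "m > 0" "(1 :: int fps) - fps_X ^ m = 0"
  moreover have "((1 :: int fps) - fps_X ^ m) $ 0 = 1"
    using \<open>m > 0\<close> by (simp add: fps_X_power_nth)
  ultimately show False by (metis fps_zero_nth zero_neq_one)
qed

lemma single_part_gf_eq:
  assumes "m > 0"
  shows "(1 - fps_X ^ m) * single_part_gf m = 1 + fps_X ^ m"
proof (rule fps_ext)
  fix n
  have "m dvd n - m \<longleftrightarrow> m dvd n" if "n \<ge> m"
    using that by (simp add: dvd_minus_self)
  thus "((1 - fps_X ^ m) * single_part_gf m) $ n = (1 + fps_X ^ m) $ n"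
    using assms by (auto simp: left_diff_distrib fps_X_power_mult_nth single_part_gf_def
      dest: dvd_imp_le)
qed

lemma overlinings_add_replicate:
  assumes "set_mset Q \<subseteq> {1..m}" "Suc m dvd k"
  shows "overlinings (Q + replicate_mset (k div Suc m) (Suc m)) =
    overlinings Q * single_part_gf (Suc m) $ k"
proof -
  have "Suc m \<notin># Q" using assms(1) by auto
  moreover have "k div Suc m = 0 \<longleftrightarrow> k = 0" using assms(2) by (metis div_0 dvd_div_eq_0_iff)
  ultimately show ?thesis using assms(2)
    by (auto simp: overlinings_def single_part_gf_def)
qed

lemma alternating_part_sum_add_replicate:
  assumes "m dvd k"
  shows "alternating_part_sum (Q + replicate_mset (k div m) m) =
    alternating_part_sum Q + (if odd m then 1 else -1) * int k"
proof -
  have "filter_mset odd (replicate_mset c m) = (if odd m then replicate_mset c m else {#})"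
       "filter_mset even (replicate_mset c m) = (if odd m then {#} else replicate_mset c m)" for c
    by (induction c) auto
  with assms show ?thesis
    by (auto simp: alternating_part_sum_def odd_part_sum_def even_part_sum_def)
qed

lemma bounded_gf_0: "bounded_gf 0 = 1"
  by (simp add: bounded_gf_def bounded_partitions_0 fps_eq_iff overlinings_def)

lemma bounded_SOME_gf_0: "bounded_SOME_gf 0 = 0"
  by (simp add: bounded_SOME_gf_def bounded_partitions_0 fps_eq_iff
      alternating_part_sum_def odd_part_sum_def even_part_sum_def)

lemma bounded_gf_Suc: "bounded_gf (Suc m) = bounded_gf m * single_part_gf (Suc m)"
proof (rule fps_ext)
  fix n
  have "bounded_gf (Suc m) $ n = (\<Sum>i=0..n. \<Sum>Q\<in>bounded_partitions m i.
      overlinings Q * single_part_gf (Suc m) $ (n - i))"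
    unfolding bounded_gf_def fps_nth_Abs_fps sum_bounded_partitions_Suc
    by (intro sum.cong refl)
      (auto simp: bounded_partitions_def overlinings_add_replicate single_part_gf_def)
  thus "bounded_gf (Suc m) $ n = (bounded_gf m * single_part_gf (Suc m)) $ n"
    by (simp add: fps_mult_nth bounded_gf_def sum_distrib_right)
qed

text \<open>
  The statistic is additive, so the product rule applies: either it is collected from the parts at
  most \<open>m\<close>, or from the copies of \<open>m + 1\<close>. Those copies contribute plus or minus their total size,
  which is what \<open>q d/dq\<close> of the single-part series records.
\<close>

lemma bounded_SOME_gf_Suc:
  "bounded_SOME_gf (Suc m) = bounded_SOME_gf m * single_part_gf (Suc m) +
     (if odd (Suc m) then 1 else -1) * (bounded_gf m * q_deriv (single_part_gf (Suc m)))"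
    (is "_ = _ + ?e * _")
proof (rule fps_ext)
  fix n
  let ?s = "if odd (Suc m) then 1 else -1 :: int"
  have "bounded_SOME_gf (Suc m) $ n = (\<Sum>i=0..n. \<Sum>Q\<in>bounded_partitions m i.
      overlinings Q * alternating_part_sum Q * single_part_gf (Suc m) $ (n - i) +
      ?s * (overlinings Q * (int (n - i) * single_part_gf (Suc m) $ (n - i))))"
    unfolding bounded_SOME_gf_def fps_nth_Abs_fps sum_bounded_partitions_Suc
  proof (intro sum.cong refl)
    fix i Q assume "Q \<in> bounded_partitions m i"
    hence Q: "set_mset Q \<subseteq> {1..m}" by (simp add: bounded_partitions_def)
    show "(if Suc m dvd n - i
          then overlinings (Q + replicate_mset ((n - i) div Suc m) (Suc m)) *
               alternating_part_sum (Q + replicate_mset ((n - i) div Suc m) (Suc m)) else 0) =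
      overlinings Q * alternating_part_sum Q * single_part_gf (Suc m) $ (n - i) +
      ?s * (overlinings Q * (int (n - i) * single_part_gf (Suc m) $ (n - i)))"
    proof (cases "Suc m dvd n - i")
      case True
      show ?thesis
        unfolding overlinings_add_replicate[OF Q True] alternating_part_sum_add_replicate[OF True]
        using True by (simp add: algebra_simps)
    qed (simp add: single_part_gf_def)
  qed
  also have "\<dots> = (bounded_SOME_gf m * single_part_gf (Suc m)) $ n
      + ?s * (bounded_gf m * q_deriv (single_part_gf (Suc m))) $ n"
    unfolding fps_mult_nth q_deriv_nth
    by (simp add: bounded_SOME_gf_def bounded_gf_def sum.distrib
        sum_distrib_left sum_distrib_right mult_ac)
  finally show "bounded_SOME_gf (Suc m) $ n = (bounded_SOME_gf m * single_part_gf (Suc m) +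
     ?e * (bounded_gf m * q_deriv (single_part_gf (Suc m)))) $ n"
    by auto
qed

lemma bounded_gf_recurrence:
  "(1 - fps_X ^ Suc m) * bounded_gf (Suc m) = (1 + fps_X ^ Suc m) * bounded_gf m"
  using single_part_gf_eq[of "Suc m"] unfolding bounded_gf_Suc
  by (metis mult.left_commute mult.commute zero_less_Suc)

text \<open>
  The sign that distinguishes odd from even parts is absorbed by \<open>q \<mapsto> -q\<close>. For even \<open>m\<close> the
  single-part series \<open>B\<close> is invariant under it; for odd \<open>m\<close> it is inverted, \<open>B(q) B(-q) = 1\<close>, and
  differentiating this equation produces the opposite sign.
\<close>

lemma single_part_neg_arg:
  assumes "m > 0"
  shows "(if odd m then 1 else -1) * q_deriv (single_part_gf m) * neg_arg (single_part_gf m) =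
    - (single_part_gf m * q_deriv (neg_arg (single_part_gf m)))"
proof (cases "odd m")
  case False
  have "neg_arg (single_part_gf m) = single_part_gf m"
    using False by (auto simp: fps_eq_iff neg_arg_nth single_part_gf_def)
  thus ?thesis using False by (simp add: mult_ac)
next
  case True
  let ?B = "single_part_gf m"
  have "neg_arg ((1 - fps_X ^ m) * ?B) = neg_arg (1 + fps_X ^ m)"
    using single_part_gf_eq[OF assms] by simp
  moreover have "neg_arg (fps_X ^ m) = - (fps_X ^ m)"
    using True by (auto simp: fps_eq_iff neg_arg_nth)
  ultimately have neg: "(1 + fps_X ^ m) * neg_arg ?B = 1 - fps_X ^ m"
    by (simp add: neg_arg_mult fps_compose_sub_distrib fps_compose_add_distrib)
  have "(1 - fps_X ^ m) * (?B * neg_arg ?B) = (1 - fps_X ^ m) * 1"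
    using single_part_gf_eq[OF assms] neg by (metis mult.assoc mult.commute mult_1_right)
  hence "?B * neg_arg ?B = 1"
    using one_minus_X_power_nonzero[OF assms] by (simp only: mult_cancel_left) simp
  hence "q_deriv (?B * neg_arg ?B) = 0" by (simp add: q_deriv_def)
  hence "q_deriv ?B * neg_arg ?B + ?B * q_deriv (neg_arg ?B) = 0"
    by (simp only: q_deriv_mult)
  thus ?thesis using True by (simp add: eq_neg_iff_add_eq_0)
qed

text \<open>
  With \<open>A\<close> for the plain and \<open>T\<close> for the weighted series this says
  \<open>T(q) / A(q) = - (q d/dq) log A(-q)\<close>. Both sides are additive over the factors of the product
  \<open>A\<close>, so only a single factor has to be checked.
\<close>

lemma bounded_SOME_gf_eq:
  "bounded_SOME_gf m * neg_arg (bounded_gf m) = - (bounded_gf m * q_deriv (neg_arg (bounded_gf m)))"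
proof (induction m)
  case 0
  thus ?case by (simp add: bounded_SOME_gf_0 bounded_gf_0 q_deriv_def)
next
  case (Suc m)
  let ?A = "bounded_gf m" and ?B = "single_part_gf (Suc m)" and ?T = "bounded_SOME_gf m"
  let ?e = "if odd (Suc m) then 1 else -1 :: int fps"
  have "bounded_SOME_gf (Suc m) * neg_arg (bounded_gf (Suc m)) =
     (?T * neg_arg ?A) * (?B * neg_arg ?B) + ?A * neg_arg ?A * (?e * q_deriv ?B * neg_arg ?B)"
    unfolding bounded_SOME_gf_Suc bounded_gf_Suc neg_arg_mult by (simp only: algebra_simps)
  also have "\<dots> = - (?A * q_deriv (neg_arg ?A)) * (?B * neg_arg ?B)
     + ?A * neg_arg ?A * (- (?B * q_deriv (neg_arg ?B)))"
    unfolding Suc.IH single_part_neg_arg[OF zero_less_Suc] ..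
  also have "\<dots> = - (bounded_gf (Suc m) * q_deriv (neg_arg (bounded_gf (Suc m))))"
    unfolding bounded_gf_Suc neg_arg_mult q_deriv_mult by algebra
  finally show ?case .
qed

section \<open>The logarithmic derivative identity\<close>

definition overpartition_gf :: "int fps" where
  "overpartition_gf = Abs_fps (\<lambda>n. int (card (overpartitions n)))"

definition SOME_gf :: "int fps" where
  "SOME_gf = Abs_fps SOME_bar"

lemma overpartition_gf_nth: "n \<le> m \<Longrightarrow> overpartition_gf $ n = bounded_gf m $ n"
  using sum_overpartitions[of n m "\<lambda>_. 1"]
  by (simp add: overpartition_gf_def bounded_gf_def case_prod_unfold)

lemma SOME_gf_nth: "n \<le> m \<Longrightarrow> SOME_gf $ n = bounded_SOME_gf m $ n"
  using sum_overpartitions[of n m alternating_part_sum]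
  by (simp add: SOME_gf_def SOME_bar_def bounded_SOME_gf_def alternating_part_sum_def)

text \<open>
  The coefficient of \<open>q^n\<close> on either side involves only coefficients up to \<open>n\<close>, which do not change
  when parts above \<open>n\<close> are forbidden. This replaces a limit over \<open>m\<close>.
\<close>

lemma SOME_gf_eq_log_derivative:
  "SOME_gf * neg_arg overpartition_gf = - (overpartition_gf * q_deriv (neg_arg overpartition_gf))"
proof (rule fps_ext)
  fix n
  have "(SOME_gf * neg_arg overpartition_gf) $ n = (bounded_SOME_gf n * neg_arg (bounded_gf n)) $ n"
    by (simp add: fps_mult_nth neg_arg_nth overpartition_gf_nth[of _ n] SOME_gf_nth[of _ n])
  also have "\<dots> = - (bounded_gf n * q_deriv (neg_arg (bounded_gf n))) $ n"
    unfolding bounded_SOME_gf_eq by simp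
  also have "\<dots> = - (overpartition_gf * q_deriv (neg_arg overpartition_gf)) $ n"
    unfolding fps_neg_nth fps_mult_nth[of "bounded_gf n"] fps_mult_nth[of overpartition_gf]
      q_deriv_nth neg_arg_nth
    by (simp add: overpartition_gf_nth[of _ n])
  finally show "(SOME_gf * neg_arg overpartition_gf) $ n =
     (- (overpartition_gf * q_deriv (neg_arg overpartition_gf))) $ n" by simp
qed

section \<open>Gauss's identity\<close>

text \<open>
  The theta series \<open>\<phi>(q)\<close>, the sum of \<open>q^(k^2)\<close> over all integers \<open>k\<close>.
\<close>

definition theta :: "int fps" where
  "theta = Abs_fps (\<lambda>n. int (card {k::int. k^2 = int n}))"

lemma square_roots_square: "{k::int. k^2 = int (j^2)} = {int j, - int j}"
  by (auto simp: power2_eq_iff)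

lemma theta_nth_square: "theta $ (j^2) = (if j = 0 then 1 else 2)"
  unfolding theta_def fps_nth_Abs_fps square_roots_square by simp

lemma theta_nth_nonsquare: "\<nexists>j. n = j^2 \<Longrightarrow> theta $ n = 0"
proof -
  assume *: "\<nexists>j. n = j^2"
  have "k^2 \<noteq> int n" for k :: int
  proof
    assume "k^2 = int n"
    hence "int n = int ((nat \<bar>k\<bar>)^2)" by simp
    thus False using * by (metis of_nat_eq_iff)
  qed
  hence "{k::int. k^2 = int n} = {}" by simp
  thus ?thesis by (simp add: theta_def)
qed

definition alternating_theta_sum :: "nat \<Rightarrow> int fps" where
  "alternating_theta_sum n = 1 + 2 * (\<Sum>j=1..n. (-1) ^ j * fps_X ^ (j^2))"

lemma alternating_theta_sum_nth:
  assumes "k \<le> n"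
  shows "alternating_theta_sum n $ k = neg_arg theta $ k"
proof -
  have coeff: "alternating_theta_sum n $ k =
      (if k = 0 then 1 else 0) + 2 * (\<Sum>j=1..n. if k = j^2 then (-1)^j else 0)"
  proof -
    have "((-1) ^ j * fps_X ^ (j^2)) $ k = (if k = j^2 then (-1)^j else (0::int))" for j
      by (cases "even j") auto
    moreover have "(2 * f) $ k = 2 * f $ k" for f :: "int fps"
      by (simp only: mult_2 fps_add_nth)
    ultimately show ?thesis
      unfolding alternating_theta_sum_def fps_add_nth fps_one_nth
      by (simp only: fps_sum_nth)
  qed
  show ?thesis
  proof (cases "\<exists>j. k = j^2")
    case False
    hence "k \<noteq> 0" by (metis zero_power2)
    thus ?thesis using False unfolding coeff neg_arg_nth
      by (simp add: theta_nth_nonsquare)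
  next
    case True
    then obtain i where i: "k = i^2" by blast
    have "i \<le> n" using assms i by (metis le_trans power2_nat_le_imp_le order_refl)
    have "(\<Sum>j=1..n. if k = j^2 then (-1)^j else (0::int)) =
        (\<Sum>j=1..n. if j = i then (-1)^i else 0)"
      unfolding i by (intro sum.cong) auto
    moreover have "(-1) ^ (i^2) = (-1 :: int) ^ i" by (cases "even i") auto
    ultimately show ?thesis using \<open>i \<le> n\<close> unfolding coeff neg_arg_nth
      by (auto simp: i theta_nth_square)
  qed
qed

text \<open>
  Shanks found a finite form of Gauss's identity: the product of the overpartition series with parts
  at most \<open>n\<close> and the \<open>n\<close>-th partial sum of \<open>\<phi>(-q)\<close> is the sum below with \<open>r = n\<close>. Its terms with
  \<open>s \<ge> 1\<close> all start beyond \<open>q^n\<close>, so that only \<open>1\<close> survives in the limit. The upper limit \<open>r\<close> is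
  kept separate from \<open>n\<close> so that the induction step in \<open>n\<close> can be proved by induction on \<open>r\<close>.
\<close>

definition shanks_sum :: "nat \<Rightarrow> nat \<Rightarrow> int fps" where
  "shanks_sum n r = 1 + (\<Sum>s=1..r. (-1) ^ s * fps_X ^ (s * (n + 1)) *
     (bounded_gf s + bounded_gf (s - 1)))"

lemma shanks_sum_Suc:
  "shanks_sum n (Suc r) = shanks_sum n r +
     (-1) ^ Suc r * fps_X ^ (Suc r * (n + 1)) * (bounded_gf (Suc r) + bounded_gf r)"
  by (simp add: shanks_sum_def)

text \<open>
  Write \<open>A_s\<close> for the overpartition series with parts at most \<open>s\<close>. Since
  \<open>(1 - q^s) (A_s + A_(s-1)) = 2 A_(s-1)\<close> and \<open>(1 + q^s) (A_s + A_(s-1)) = 2 A_s\<close>, each term of the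
  difference is itself a difference of two consecutive values of the right-hand side.
\<close>

lemma shanks_sum_telescope:
  "(1 - fps_X ^ Suc n) * shanks_sum (Suc n) r - (1 + fps_X ^ Suc n) * shanks_sum n r =
     - 2 * (-1) ^ r * fps_X ^ (Suc r * Suc n) * bounded_gf r"
proof (induction r)
  case 0
  thus ?case by (simp add: shanks_sum_def bounded_gf_0)
next
  case (Suc r)
  let ?A = "bounded_gf r" and ?A' = "bounded_gf (Suc r)"
  define x :: "int fps" where "x = fps_X ^ Suc r"
  define y :: "int fps" where "y = fps_X ^ Suc n"
  define z :: "int fps" where "z = fps_X ^ (Suc r * Suc n)"
  define e :: "int fps" where "e = (-1) ^ r"
  have rec: "(1 - x) * ?A' = (1 + x) * ?A"
    unfolding x_def by (rule bounded_gf_recurrence)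
  \<comment> \<open>these turn the new terms of the two sums into consecutive values of the right-hand side\<close>
  have sums: "(1 - x) * (?A' + ?A) = 2 * ?A" "(1 + x) * (?A' + ?A) = 2 * ?A'"
    using rec by (simp_all add: algebra_simps)
  have pows: "fps_X ^ (Suc r * (n + 1)) = z" "fps_X ^ (Suc r * (Suc n + 1)) = z * x"
       "fps_X ^ (Suc (Suc r) * Suc n) = z * y" "(-1) ^ Suc r = - e"
    by (simp_all add: x_def y_def z_def e_def algebra_simps flip: power_add)
  have IH: "(1 - y) * shanks_sum (Suc n) r - (1 + y) * shanks_sum n r = - 2 * e * z * ?A"
    using Suc.IH by (simp add: y_def z_def e_def)
  show ?case
  proof -
    let ?S = "shanks_sum (Suc n) r" and ?S' = "shanks_sum n r"
    have "(1 - y) * (?S + - e * (z * x) * (?A' + ?A)) - (1 + y) * (?S' + - e * z * (?A' + ?A)) =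
        ((1 - y) * ?S - (1 + y) * ?S') + e * z * ((1 - x) * (?A' + ?A))
          + e * z * y * ((1 + x) * (?A' + ?A))"
      by (simp add: algebra_simps)
    also have "\<dots> = - 2 * - e * (z * y) * ?A'"
      unfolding IH sums by (simp add: algebra_simps)
    finally show ?thesis unfolding shanks_sum_Suc pows y_def[symmetric] .
  qed
qed

lemma shanks_sum_step:
  "(1 - fps_X ^ Suc n) * shanks_sum (Suc n) (Suc n) = (1 + fps_X ^ Suc n) *
     (shanks_sum n n + 2 * (-1) ^ Suc n * fps_X ^ ((Suc n)^2) * bounded_gf n)"
proof -
  let ?A = "bounded_gf n" and ?A' = "bounded_gf (Suc n)"
  define y :: "int fps" where "y = fps_X ^ Suc n"
  define z :: "int fps" where "z = fps_X ^ ((Suc n)^2)"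
  define e :: "int fps" where "e = (-1) ^ n"
  have rec: "(1 - y) * ?A' = (1 + y) * ?A"
    unfolding y_def by (rule bounded_gf_recurrence)
  have sums: "(1 - y) * (?A' + ?A) = 2 * ?A"
    using rec by (simp add: algebra_simps)
  have tele: "(1 - y) * shanks_sum (Suc n) n - (1 + y) * shanks_sum n n = - 2 * e * z * ?A"
    using shanks_sum_telescope[of n n] by (simp only: y_def z_def e_def power2_eq_square)
  have pows: "fps_X ^ (Suc n * (Suc n + 1)) = z * y" "(-1) ^ Suc n = - e"
    by (simp_all add: y_def z_def e_def power2_eq_square algebra_simps flip: power_add)
  show ?thesis
  proof -
    let ?S = "shanks_sum (Suc n) n" and ?S' = "shanks_sum n n"
    have "(1 - y) * (?S + - e * (z * y) * (?A' + ?A)) =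
        ((1 - y) * ?S - (1 + y) * ?S') + (1 + y) * ?S' - e * z * y * ((1 - y) * (?A' + ?A))"
      by (simp add: algebra_simps)
    also have "\<dots> = (1 + y) * (?S' + 2 * - e * z * ?A)"
      unfolding tele sums by (simp add: algebra_simps)
    finally show ?thesis
      unfolding shanks_sum_Suc pows y_def[symmetric] z_def[symmetric] .
  qed
qed

text \<open>
  Passing from \<open>n\<close> to \<open>n + 1\<close> multiplies the overpartition series by
  \<open>(1 + q^(n+1)) / (1 - q^(n+1))\<close> and adds one term to the theta sum. The denominator is cleared
  first, to stay inside integer power series.
\<close>

lemma shanks_identity: "bounded_gf n * alternating_theta_sum n = shanks_sum n n"
proof (induction n)
  case 0
  thus ?case by (simp add: bounded_gf_0 alternating_theta_sum_def shanks_sum_def)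
next
  case (Suc n)
  have sum: "alternating_theta_sum (Suc n) =
      alternating_theta_sum n + 2 * (-1) ^ Suc n * fps_X ^ ((Suc n)^2)"
  proof -
    have "(\<Sum>j=1..Suc n. g j) = (\<Sum>j=1..n. g j) + g (Suc n)" for g :: "nat \<Rightarrow> int fps"
      by simp
    thus ?thesis
      unfolding alternating_theta_sum_def by (simp only: distrib_left add.assoc mult.assoc)
  qed
  have "(1 - fps_X ^ Suc n) * (bounded_gf (Suc n) * alternating_theta_sum (Suc n)) =
      (1 + fps_X ^ Suc n) * (bounded_gf n * alternating_theta_sum (Suc n))"
    unfolding mult.assoc[symmetric] bounded_gf_recurrence ..
  also have "\<dots> = (1 + fps_X ^ Suc n) *
     (shanks_sum n n + 2 * (-1) ^ Suc n * fps_X ^ ((Suc n)^2) * bounded_gf n)"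
    unfolding sum Suc.IH[symmetric] by (simp only: algebra_simps)
  also have "\<dots> = (1 - fps_X ^ Suc n) * shanks_sum (Suc n) (Suc n)"
    by (rule shanks_sum_step[symmetric])
  finally show ?case
    using one_minus_X_power_nonzero[of "Suc n"] by (simp only: mult_cancel_left) simp
qed

lemma gauss_identity: "overpartition_gf * neg_arg theta = 1"
proof (rule fps_ext)
  fix n
  have "(overpartition_gf * neg_arg theta) $ n = (bounded_gf n * alternating_theta_sum n) $ n"
    unfolding fps_mult_nth
    by (intro sum.cong refl) (simp add: overpartition_gf_nth[of _ n] alternating_theta_sum_nth)
  also have "\<dots> = 1 $ n + (\<Sum>s=1..n. (fps_X ^ (s * (n + 1)) *
      ((-1) ^ s * (bounded_gf s + bounded_gf (s - 1)))) $ n)"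
    unfolding shanks_identity shanks_sum_def by (simp add: fps_sum_nth mult_ac)
  also have "(\<Sum>s=1..n. (fps_X ^ (s * (n + 1)) *
      ((-1) ^ s * (bounded_gf s + bounded_gf (s - 1)))) $ n) = 0"
  proof (intro sum.neutral ballI)
    fix s assume "s \<in> {1..n}"
    hence "n < s * (n + 1)" by (cases s) auto
    thus "(fps_X ^ (s * (n + 1)) * ((-1) ^ s * (bounded_gf s + bounded_gf (s - 1)))) $ n = 0"
      by (simp only: fps_X_power_mult_nth) simp
  qed
  finally show "(overpartition_gf * neg_arg theta) $ n = 1 $ n" by simp
qed

abbreviation dilate :: "nat \<Rightarrow> int fps \<Rightarrow> int fps" where
  "dilate d f \<equiv> fps_compose f (fps_X ^ d)"

lemma dilate_mult: "d > 0 \<Longrightarrow> dilate d (f * g) = dilate d f * dilate d g"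
  by (rule fps_compose_mult_distrib) (simp add: fps_X_power_nth)

lemma dilate_power: "d > 0 \<Longrightarrow> dilate d (f ^ n) = dilate d f ^ n"
  by (rule fps_compose_power[symmetric]) (simp add: fps_X_power_nth)

lemma dilate_dilate: "d > 0 \<Longrightarrow> e > 0 \<Longrightarrow> dilate d (dilate e f) = dilate (e * d) f"
  by (auto simp: fps_eq_iff fps_nth_compose_X_power dvd_div_iff_mult div_mult2_eq mult_ac)

section \<open>Sums of two squares\<close>

definition sum_two_squares :: "nat \<Rightarrow> (int \<times> int) set" where
  "sum_two_squares n = {(a, b). a^2 + b^2 = int n}"

lemma finite_square_roots: "finite {k::int. k^2 = int n}"
proof (rule finite_subset)
  show "{k::int. k^2 = int n} \<subseteq> {- int n..int n}"
  proof
    fix k :: int assume "k \<in> {k. k^2 = int n}"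
    hence "k^2 = int n" by simp
    moreover have "\<bar>k\<bar> \<le> k^2" by (cases "k = 0") (use self_le_power[of "\<bar>k\<bar>" 2] in auto)
    ultimately show "k \<in> {- int n..int n}" by auto
  qed
qed simp

lemma sum_over_two_squares:
  fixes f g :: "int \<Rightarrow> int"
  shows "(Abs_fps (\<lambda>n. \<Sum>a\<in>{k. k^2 = int n}. f a) *
      Abs_fps (\<lambda>n. \<Sum>b\<in>{k. k^2 = int n}. g b)) $ n =
    (\<Sum>(a, b)\<in>sum_two_squares n. f a * g b)"
proof -
  let ?R = "\<lambda>n. {k::int. k^2 = int n}"
  have "(Abs_fps (\<lambda>n. \<Sum>a\<in>?R n. f a) * Abs_fps (\<lambda>n. \<Sum>b\<in>?R n. g b)) $ n =
      (\<Sum>i=0..n. \<Sum>(a, b)\<in>?R i \<times> ?R (n - i). f a * g b)"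
    by (simp add: fps_mult_nth sum_product sum.cartesian_product)
  also have "\<dots> = (\<Sum>(i, a, b)\<in>(SIGMA i:{0..n}. ?R i \<times> ?R (n - i)). f a * g b)"
    by (rule sum.Sigma) (auto simp del: of_nat_diff
      intro: finite_cartesian_product finite_square_roots)
  also have "\<dots> = (\<Sum>(a, b)\<in>sum_two_squares n. f a * g b)"
  proof (rule sum.reindex_bij_witness[where
        i = "\<lambda>(a, b). (nat (a^2), a, b)" and j = "\<lambda>(i, a, b). (a, b)"])
    fix ab assume "ab \<in> sum_two_squares n"
    then obtain a b where ab: "ab = (a, b)" and *: "a^2 + b^2 = int n"
      by (auto simp: sum_two_squares_def)
    have "nat (a^2) \<le> n" using * zero_le_power2[of b] by linarith
    thus "(case ab of (a, b) \<Rightarrow> (nat (a^2), a, b)) \<in> (SIGMA i:{0..n}. ?R i \<times> ?R (n - i))"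
      using * by (simp add: ab of_nat_diff)
  qed (auto simp: sum_two_squares_def of_nat_diff)
  finally show ?thesis .
qed

lemma theta_eq: "theta = Abs_fps (\<lambda>n. \<Sum>a\<in>{k. k^2 = int n}. 1)"
  by (simp add: theta_def)

lemma neg_arg_theta_eq:
  "neg_arg theta = Abs_fps (\<lambda>n. \<Sum>a\<in>{k. k^2 = int n}. if even a then 1 else -1)"
proof (rule fps_ext)
  fix n
  have "(if even a then 1 else -1) = (-1::int) ^ n" if "a^2 = int n" for a :: int
  proof -
    have "even a \<longleftrightarrow> even n" using that by (metis even_of_nat even_power pos2)
    thus ?thesis by auto
  qed
  hence "(\<Sum>a\<in>{k. k^2 = int n}. if even a then 1 else -1) = (\<Sum>a\<in>{k. k^2 = int n}. (-1::int) ^ n)"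
    by (intro sum.cong) auto
  thus "neg_arg theta $ n = Abs_fps (\<lambda>n. \<Sum>a\<in>{k. k^2 = int n}. if even a then 1 else -1) $ n"
    by (simp add: neg_arg_nth theta_def)
qed

lemma finite_sum_two_squares: "finite (sum_two_squares n)"
proof (rule finite_subset)
  show "sum_two_squares n \<subseteq> (\<Union>i\<le>n. {k. k^2 = int i}) \<times> (\<Union>i\<le>n. {k. k^2 = int i})"
  proof clarify
    fix a b assume "(a, b) \<in> sum_two_squares n"
    hence *: "a^2 + b^2 = int n" by (simp add: sum_two_squares_def)
    have "nat (a^2) \<le> n" "nat (b^2) \<le> n"
      using * zero_le_power2[of a] zero_le_power2[of b] by linarith+
    moreover have "a^2 = int (nat (a^2))" "b^2 = int (nat (b^2))" by simp_all
    ultimately show "a \<in> (\<Union>i\<le>n. {k. k^2 = int i}) \<and> b \<in> (\<Union>i\<le>n. {k. k^2 = int i})"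
      by blast
  qed
qed (simp add: finite_square_roots)

text \<open>
  The identity \<open>\<phi>(q) \<phi>(-q) = \<phi>(-q^2)^2\<close>. The left-hand side counts the pairs \<open>(a, b)\<close> with
  \<open>a^2 + b^2 = n\<close>, with sign \<open>(-1)^b\<close>. Exchanging \<open>a\<close> and \<open>b\<close> cancels the pairs of different parity;
  those of equal parity are \<open>(x + y, x - y)\<close> with \<open>x^2 + y^2 = n/2\<close>, and their sign is
  \<open>(-1)^(x + y)\<close>.
\<close>

lemma theta_mult_neg_arg_theta: "theta * neg_arg theta = dilate 2 (neg_arg theta ^ 2)"
proof (rule fps_ext)
  fix n
  let ?s = "\<lambda>b::int. if even b then 1 else -1 :: int"
  have lhs: "(theta * neg_arg theta) $ n = (\<Sum>(a, b)\<in>sum_two_squares n. ?s b)"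
    unfolding neg_arg_theta_eq unfolding theta_eq sum_over_two_squares by simp
  \<comment> \<open>exchanging \<open>a\<close> and \<open>b\<close> reverses the sign when the parities differ\<close>
  have swap: "(\<Sum>(a, b)\<in>{(a, b)\<in>sum_two_squares n. even a \<noteq> even b}. ?s b) = 0"
  proof -
    let ?D = "{(a, b)\<in>sum_two_squares n. even a \<noteq> even b}"
    have "(\<Sum>(a, b)\<in>?D. ?s b) = (\<Sum>(a, b)\<in>?D. ?s a)"
      by (rule sum.reindex_bij_witness[where i = prod.swap and j = prod.swap])
         (auto simp: sum_two_squares_def add.commute)
    moreover have "(\<Sum>(a, b)\<in>?D. ?s a) = (\<Sum>(a, b)\<in>?D. - ?s b)"
      by (intro sum.cong) auto
    ultimately show ?thesis by (simp add: sum_negf case_prod_unfold)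
  qed
  have "sum_two_squares n = {(a, b)\<in>sum_two_squares n. even a = even b} \<union>
      {(a, b)\<in>sum_two_squares n. even a \<noteq> even b}" by auto
  hence "(\<Sum>(a, b)\<in>sum_two_squares n. ?s b) =
      (\<Sum>(a, b)\<in>{(a, b)\<in>sum_two_squares n. even a = even b}. ?s b) +
      (\<Sum>(a, b)\<in>{(a, b)\<in>sum_two_squares n. even a \<noteq> even b}. ?s b)"
    by (subst sum.union_disjoint[symmetric])
       (auto intro: finite_subset[OF _ finite_sum_two_squares[of n]])
  hence same: "(theta * neg_arg theta) $ n =
      (\<Sum>(a, b)\<in>{(a, b)\<in>sum_two_squares n. even a = even b}. ?s b)"
    using lhs swap by simp
  show "(theta * neg_arg theta) $ n = dilate 2 (neg_arg theta ^ 2) $ n"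
  proof (cases "even n")
    case False
    have empty: "{(a, b)\<in>sum_two_squares n. even a = even b} = {}"
    proof -
      have "even a \<noteq> even b" if "a^2 + b^2 = int n" for a b :: int
        using that False by (metis even_add even_of_nat even_power pos2)
      thus ?thesis by (auto simp: sum_two_squares_def)
    qed
    show ?thesis unfolding same empty using False by (simp add: fps_nth_compose_X_power)
  next
    case True
    then obtain m where m: "n = 2 * m" by blast
    have "(\<Sum>(a, b)\<in>{(a, b)\<in>sum_two_squares n. even a = even b}. ?s b) =
        (\<Sum>(x, y)\<in>sum_two_squares m. ?s x * ?s y)"
    proof (rule sum.reindex_bij_witness[where i = "\<lambda>(x, y). (x + y, x - y)" and
          j = "\<lambda>(a, b). ((a + b) div 2, (a - b) div 2)"])
      fix ab assume "ab \<in> {(a, b)\<in>sum_two_squares n. even a = even b}"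
      then obtain a b where ab: "ab = (a, b)" and sq: "a^2 + b^2 = int n" and par: "even a = even b"
        by (auto simp: sum_two_squares_def)
      from par have "even (a + b)" by simp
      then obtain x where x: "a + b = 2 * x" by blast
      define y where "y = a - x"
      have ay: "a = x + y" "b = x - y" using x by (auto simp: y_def)
      have "x^2 + y^2 = int m"
        using sq unfolding ay m by (simp add: power2_eq_square algebra_simps)
      thus "(case ab of (a, b) \<Rightarrow> ((a + b) div 2, (a - b) div 2)) \<in> sum_two_squares m"
        by (simp add: ab ay sum_two_squares_def)
      show "(case case ab of (a, b) \<Rightarrow> ((a + b) div 2, (a - b) div 2) of
          (x, y) \<Rightarrow> (x + y, x - y)) = ab"
        by (simp add: ab ay)
      show "(case case ab of (a, b) \<Rightarrow> ((a + b) div 2, (a - b) div 2) of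
          (x, y) \<Rightarrow> ?s x * ?s y) = (case ab of (a, b) \<Rightarrow> ?s b)"
        by (simp add: ab ay)
    qed (auto simp: sum_two_squares_def m power2_eq_square algebra_simps)
    also have "\<dots> = (neg_arg theta ^ 2) $ m"
      unfolding power2_eq_square[of "neg_arg theta"]
      unfolding neg_arg_theta_eq sum_over_two_squares ..
    finally show ?thesis using same by (simp add: m fps_nth_compose_X_power)
  qed
qed

section \<open>Factorization of the generating function\<close>

lemma overpartition_gf_neg_arg: "neg_arg overpartition_gf * theta = 1"
  using arg_cong[OF gauss_identity, of neg_arg] by (simp add: neg_arg_mult neg_arg_neg_arg)

text \<open>
  As \<open>A(q) = 1 / \<phi>(-q)\<close>, this is \<open>\<phi>(q) \<phi>(-q) = \<phi>(-q^2)^2\<close> again. It trades \<open>A\<close> for a theta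
  series with explicit coefficients and a series in \<open>q^2\<close>; it can be iterated.
\<close>

lemma overpartition_gf_dissection:
  "overpartition_gf = theta * dilate 2 overpartition_gf ^ 2"
proof -
  let ?A = overpartition_gf
  have "dilate 2 (?A * neg_arg theta) ^ 2 = 1" unfolding gauss_identity by simp
  hence "dilate 2 ?A ^ 2 * dilate 2 (neg_arg theta ^ 2) = 1"
    by (simp add: dilate_mult dilate_power power_mult_distrib)
  hence "dilate 2 ?A ^ 2 * theta * neg_arg theta = 1"
    by (simp add: theta_mult_neg_arg_theta[symmetric] mult_ac)
  thus ?thesis using gauss_identity by algebra
qed

text \<open>
  With \<open>A(-q) = 1 / \<phi>(q)\<close>, minus the logarithmic derivative of \<open>A(-q)\<close> is that of \<open>\<phi>\<close>, so the
  series is \<open>q \<phi>'(q) A(q) A(-q)\<close>; and \<open>A(q) A(-q) = A(q^2)^2\<close>.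
\<close>

lemma SOME_gf_eq_theta: "SOME_gf = q_deriv theta * dilate 2 overpartition_gf ^ 2"
proof -
  let ?A = overpartition_gf
  have "q_deriv (neg_arg ?A * theta) = 0"
    unfolding overpartition_gf_neg_arg by (simp add: q_deriv_def)
  hence "q_deriv (neg_arg ?A) * theta + neg_arg ?A * q_deriv theta = 0"
    by (simp only: q_deriv_mult)
  hence "SOME_gf * (neg_arg ?A * theta) * (neg_arg ?A * theta) =
      ?A * neg_arg ?A * q_deriv theta * (neg_arg ?A * theta)"
    using SOME_gf_eq_log_derivative by algebra
  hence 1: "SOME_gf = ?A * neg_arg ?A * q_deriv theta" by (simp add: overpartition_gf_neg_arg)
  have "?A * neg_arg ?A = dilate 2 ?A ^ 2"
    using overpartition_gf_dissection overpartition_gf_neg_arg by algebra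
  thus ?thesis using 1 by (simp add: mult_ac)
qed

text \<open>
  The dissection applied to \<open>A(q^2)\<close> and then to \<open>A(q^4)\<close>. Nothing but \<open>A(q^8)\<close> is left of the
  overpartition series, and this is invisible modulo 8 in the exponents.
\<close>

lemma SOME_gf_factorization:
  "SOME_gf = q_deriv theta * dilate 2 (theta ^ 2) *
     dilate 4 (theta ^ 4 * dilate 2 (overpartition_gf ^ 8))"
proof -
  let ?A = overpartition_gf
  have 2: "dilate 2 ?A = dilate 2 theta * dilate 4 ?A ^ 2"
    using arg_cong[OF overpartition_gf_dissection, of "dilate 2"]
    by (simp add: dilate_mult dilate_power[symmetric] dilate_dilate)
  have 4: "dilate 4 ?A = dilate 4 theta * dilate 8 ?A ^ 2"
    using arg_cong[OF overpartition_gf_dissection, of "dilate 4"]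
    by (simp add: dilate_mult dilate_power[symmetric] dilate_dilate)
  have "dilate 2 ?A ^ 2 = dilate 2 theta ^ 2 * (dilate 4 theta ^ 4 * dilate 8 ?A ^ 8)"
    unfolding 2 4 by (simp add: power_mult_distrib flip: power_mult)
  also have "\<dots> = dilate 2 (theta ^ 2) * dilate 4 (theta ^ 4 * dilate 2 (?A ^ 8))"
    by (simp add: dilate_mult dilate_power dilate_dilate)
  finally show ?thesis unfolding SOME_gf_eq_theta by (simp add: mult_ac)
qed

section \<open>Residues of squares modulo 8\<close>

lemma square_residue_mod_4:
  fixes i :: nat
  assumes "i mod 8 \<in> {0, 1, 4}"
  shows "i mod 4 \<in> {0, 1}"
proof -
  have "i mod 4 = i mod 8 mod 4" by (simp add: mod_mod_cancel)
  thus ?thesis using assms by auto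
qed

lemma add_square_residues_mod_4:
  fixes i j :: nat
  assumes "i mod 8 \<in> {0, 1, 4}" "j mod 8 \<in> {0, 1, 4}"
  shows "(i + j) mod 4 \<noteq> 3"
  using square_residue_mod_4[OF assms(1)] square_residue_mod_4[OF assms(2)] mod_add_eq[of i 4 j]
  by auto

lemma residue_2_mod_4_forced:
  fixes i j k :: nat
  assumes "i mod 8 \<in> {0, 1, 4}" "even j" "4 dvd k" "(i + (j + k)) mod 4 = 3"
  shows "j mod 4 = 2"
proof -
  have "i mod 4 = 0 \<or> i mod 4 = 1" using square_residue_mod_4[OF assms(1)] by auto
  thus ?thesis using assms(2-) by presburger
qed

text \<open>
  Here \<open>i\<close>, \<open>j\<close>, \<open>k\<close> stand for exponents of \<open>q \<phi>'(q)\<close>, of \<open>\<phi>(q^2)^2\<close> and of the factor in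
  \<open>q^4\<close>. As \<open>i\<close> is odd, \<open>i mod 8 = 1\<close>; then \<open>j\<close> cannot be divisible by 4, so \<open>j mod 8 = 2\<close>, and 4
  is left for \<open>k\<close>.
\<close>

lemma residues_mod_8_forced:
  fixes i j k :: nat
  assumes "i mod 8 \<in> {0, 1, 4}" "even j" "4 dvd k" "(i + (j + k)) mod 8 = 7" "j mod 8 \<noteq> 6"
  shows "j mod 4 = 2 \<and> k mod 8 = 4"
proof -
  have "j mod 8 \<in> {0, 2, 4}"
  proof -
    obtain b where "j = 2 * b" using assms(2) by blast
    hence "j mod 8 = 2 * (b mod 4)" using mod_mult_mult1[of 2 b 4] by simp
    moreover have "b mod 4 = 0 \<or> b mod 4 = 1 \<or> b mod 4 = 2 \<or> b mod 4 = 3" by linarith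
    ultimately show ?thesis using assms(5) by auto
  qed
  moreover have "k mod 8 \<in> {0, 4}"
  proof -
    obtain c where "k = 4 * c" using assms(3) by blast
    hence "k mod 8 = 4 * (c mod 2)" using mod_mult_mult1[of 4 c 2] by simp
    thus ?thesis by (cases "even c") auto
  qed
  moreover have "(i mod 8 + (j mod 8 + k mod 8)) mod 8 = 7"
    using assms(4) by (metis mod_add_eq mod_add_right_eq)
  ultimately have "j mod 8 = 2 \<and> k mod 8 = 4" using assms(1) by auto
  moreover have "j mod 4 = j mod 8 mod 4" by (simp add: mod_mod_cancel)
  ultimately show ?thesis by simp
qed

lemma theta_nth_nonzero_mod_8:
  assumes "theta $ n \<noteq> 0"
  shows "n mod 8 \<in> {0, 1, 4}"
proof -
  obtain j where j: "n = j^2" using assms theta_nth_nonsquare by blast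
  have "j mod 8 \<in> {0,1,2,3,4,5,6,7}" by auto
  hence "((j mod 8)^2) mod 8 \<in> {0, 1, 4::nat}" by auto
  thus ?thesis by (simp add: j power_mod)
qed

section \<open>Divisibility of odd coefficients\<close>

definition even_supported :: "int fps \<Rightarrow> bool" where
  "even_supported f \<longleftrightarrow> (\<forall>n. odd n \<longrightarrow> f $ n = 0)"

definition odd_supported :: "int fps \<Rightarrow> bool" where
  "odd_supported f \<longleftrightarrow> (\<forall>n. even n \<longrightarrow> f $ n = 0)"

lemma fps_mult_nth_eq_0:
  fixes f g :: "int fps"
  assumes "\<And>i j. i + j = n \<Longrightarrow> f $ i = 0 \<or> g $ j = 0"
  shows "(f * g) $ n = 0"
  unfolding fps_mult_nth using assms by (intro sum.neutral) auto

lemma even_supported_mult: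
  "even_supported f \<Longrightarrow> even_supported g \<Longrightarrow> even_supported (f * g)"
  unfolding even_supported_def by (intro allI impI fps_mult_nth_eq_0) (metis even_add)

lemma even_supported_mult_odd:
  "odd_supported f \<Longrightarrow> odd_supported g \<Longrightarrow> even_supported (f * g)"
  unfolding even_supported_def odd_supported_def
  by (intro allI impI fps_mult_nth_eq_0) (metis even_add)

lemma odd_supported_mult:
  "even_supported f \<Longrightarrow> odd_supported g \<Longrightarrow> odd_supported (f * g)"
  unfolding even_supported_def odd_supported_def
  by (intro allI impI fps_mult_nth_eq_0) (metis even_add)

definition odd_part_divisible :: "int \<Rightarrow> int fps \<Rightarrow> bool" where
  "odd_part_divisible c f \<longleftrightarrow>
     (\<exists>E D. even_supported E \<and> odd_supported D \<and> f = E + fps_const c * D)"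

text \<open>
  The odd part of \<open>(E + c D)^2\<close> is \<open>2 c E D\<close>; the square of the odd part goes into the even part.
  So every squaring gains a factor 2 in the odd coefficients: 2, 4, 8 for \<open>\<phi>\<close>, \<open>\<phi>^2\<close>, \<open>\<phi>^4\<close>.
\<close>

lemma odd_part_divisible_square:
  assumes "odd_part_divisible c f"
  shows "odd_part_divisible (2 * c) (f ^ 2)"
proof -
  obtain E D where *: "even_supported E" "odd_supported D" "f = E + fps_const c * D"
    using assms by (auto simp: odd_part_divisible_def)
  have "even_supported (fps_const (c^2) * (D * D))"
    using even_supported_mult_odd[OF *(2) *(2)] by (simp add: even_supported_def)
  hence "even_supported (E * E + fps_const (c^2) * (D * D))"
    using even_supported_mult[OF *(1) *(1)] by (simp add: even_supported_def)
  moreover have "fps_const (c^2) = fps_const c * fps_const c" "fps_const (2 * c) = 2 * fps_const c"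
    by (simp_all add: power2_eq_square numeral_fps_const)
  hence "f ^ 2 = (E * E + fps_const (c^2) * (D * D)) + fps_const (2 * c) * (E * D)"
    unfolding *(3) power2_eq_square[of "_ + _"] by (simp only:) (simp add: algebra_simps)
  ultimately show ?thesis
    using odd_supported_mult[OF *(1,2)] unfolding odd_part_divisible_def by blast
qed

lemma odd_part_divisible_mult_even:
  assumes "odd_part_divisible c f" "even_supported g"
  shows "odd_part_divisible c (f * g)"
proof -
  obtain E D where *: "even_supported E" "odd_supported D" "f = E + fps_const c * D"
    using assms by (auto simp: odd_part_divisible_def)
  have "f * g = E * g + fps_const c * (g * D)" unfolding *(3) by (simp add: algebra_simps)
  thus ?thesis
    using even_supported_mult[OF *(1) assms(2)] odd_supported_mult[OF assms(2) *(2)]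
    unfolding odd_part_divisible_def by blast
qed

lemma odd_part_divisible_dvd:
  assumes "odd_part_divisible c f" "odd n"
  shows "c dvd f $ n"
  using assms by (auto simp: odd_part_divisible_def even_supported_def)

lemma odd_part_divisible_theta: "odd_part_divisible 2 theta"
proof -
  let ?E = "Abs_fps (\<lambda>n. if even n then theta $ n else 0)"
  let ?D = "Abs_fps (\<lambda>n. if odd n then theta $ n div 2 else 0)"
  have "even (theta $ n)" if "odd n" for n
  proof (cases "\<exists>j. n = j^2")
    case True
    thus ?thesis using that by (auto simp: theta_nth_square odd_pos)
  qed (simp add: theta_nth_nonsquare)
  hence "theta = ?E + fps_const 2 * ?D" by (simp add: fps_eq_iff)
  moreover have "even_supported ?E" "odd_supported ?D"
    by (auto simp: even_supported_def odd_supported_def)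
  ultimately show ?thesis unfolding odd_part_divisible_def by blast
qed

lemma odd_part_divisible_theta_square: "odd_part_divisible 4 (theta ^ 2)"
  using odd_part_divisible_square[OF odd_part_divisible_theta] by simp

lemma odd_part_divisible_theta_fourth: "odd_part_divisible 8 (theta ^ 4)"
  using odd_part_divisible_square[OF odd_part_divisible_theta_square] by (simp flip: power_mult)

section \<open>The congruences\<close>

lemma theta_square_nth_3_mod_4:
  assumes "n mod 4 = 3"
  shows "(theta ^ 2) $ n = 0"
  unfolding power2_eq_square
proof (rule fps_mult_nth_eq_0, rule ccontr)
  fix i j
  assume "i + j = n" "\<not> (theta $ i = 0 \<or> theta $ j = 0)"
  hence "i mod 8 \<in> {0, 1, 4}" "j mod 8 \<in> {0, 1, 4}"
    using theta_nth_nonzero_mod_8 by auto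
  thus False using assms \<open>i + j = n\<close> add_square_residues_mod_4[of i j] by simp
qed

lemma q_deriv_theta_even: "2 dvd q_deriv theta $ n"
proof (cases "\<exists>j. n = j^2")
  case True
  thus ?thesis by (auto simp: q_deriv_nth theta_nth_square split: if_splits)
qed (simp add: q_deriv_nth theta_nth_nonsquare)

lemma q_deriv_theta_nonzero: "q_deriv theta $ n \<noteq> 0 \<Longrightarrow> n mod 8 \<in> {0, 1, 4}"
  using theta_nth_nonzero_mod_8 by (auto simp: q_deriv_nth)

lemma dvd_fps_mult_nth:
  fixes f g :: "int fps"
  assumes "\<And>i j. i + j = n \<Longrightarrow> c dvd f $ i * g $ j"
  shows "c dvd (f * g) $ n"
  unfolding fps_mult_nth using assms by (intro dvd_sum) auto

text \<open>
  Each product of coefficients that contributes to the coefficient of \<open>q^n\<close> is divisible. The first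
  factor always gives 2. The residue of \<open>n\<close> forces an exponent congruent to 2 modulo 4 in the second
  factor, which gives 4, and for \<open>n mod 8 = 7\<close> also an exponent congruent to 4 modulo 8 in the third
  factor, which gives 8.
\<close>

lemma SOME_bar_dvd:
  shows "n mod 4 = 3 \<Longrightarrow> 8 dvd SOME_bar n" and "n mod 8 = 7 \<Longrightarrow> 64 dvd SOME_bar n"
proof -
  let ?U = "q_deriv theta" and ?V = "dilate 2 (theta ^ 2)"
  let ?W' = "theta ^ 4 * dilate 2 (overpartition_gf ^ 8)"
  let ?W = "dilate 4 ?W'"
  have SOME: "SOME_bar n = (?U * (?V * ?W)) $ n"
    using SOME_gf_factorization by (simp add: SOME_gf_def fps_eq_iff mult.assoc)
  have V_even: "even j" if "?V $ j \<noteq> 0" for j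
    using that by (metis fps_nth_compose_X_power)
  have V_dvd: "4 dvd ?V $ j" if "j mod 4 = 2" for j
  proof -
    have "even j" "odd (j div 2)" using that by presburger+
    thus ?thesis
      using odd_part_divisible_dvd[OF odd_part_divisible_theta_square]
      by (simp add: fps_nth_compose_X_power)
  qed
  have V_6: "?V $ j = 0" if "j mod 8 = 6" for j
  proof -
    have "j mod 8 = 2 * (j div 2 mod 4) + j mod 2" using mod_mult2_eq[of j 2 4] by simp
    hence "(j div 2) mod 4 = 3" using that by linarith
    thus ?thesis using theta_square_nth_3_mod_4 by (simp add: fps_nth_compose_X_power)
  qed
  have W_4: "4 dvd k" if "?W $ k \<noteq> 0" for k
    using that by (metis fps_nth_compose_X_power)
  have "even_supported (dilate 2 (overpartition_gf ^ 8))"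
    by (simp add: even_supported_def fps_nth_compose_X_power)
  note W'_odd = odd_part_divisible_mult_even[OF odd_part_divisible_theta_fourth this]
  have W_dvd: "8 dvd ?W $ k" if "k mod 8 = 4" for k
  proof -
    have "k mod 8 = 4 * (k div 4 mod 2) + k mod 4" using mod_mult2_eq[of k 4 2] by simp
    moreover have "k mod 4 = k mod 8 mod 4" by (simp add: mod_mod_cancel)
    ultimately have "k mod 4 = 0" "k div 4 mod 2 = 1" using that by simp_all
    hence "4 dvd k" "odd (k div 4)" by presburger+
    thus ?thesis using odd_part_divisible_dvd[OF W'_odd] by (simp add: fps_nth_compose_X_power)
  qed
  show "8 dvd SOME_bar n" if "n mod 4 = 3"
    unfolding SOME
  proof (rule dvd_fps_mult_nth)
    fix i l assume il: "i + l = n"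
    have "4 dvd (?V * ?W) $ l" if "?U $ i \<noteq> 0"
    proof (rule dvd_fps_mult_nth)
      fix j k assume jk: "j + k = l"
      show "4 dvd ?V $ j * ?W $ k"
      proof (cases "?V $ j = 0 \<or> ?W $ k = 0")
        case False
        hence "even j" "4 dvd k" using V_even W_4 by blast+
        moreover have "i mod 8 \<in> {0, 1, 4}" using q_deriv_theta_nonzero that by blast
        ultimately have "j mod 4 = 2"
          using il jk \<open>n mod 4 = 3\<close> by (metis residue_2_mod_4_forced)
        thus ?thesis using V_dvd by simp
      qed auto
    qed
    hence "?U $ i \<noteq> 0 \<Longrightarrow> 2 * 4 dvd ?U $ i * (?V * ?W) $ l"
      by (intro mult_dvd_mono q_deriv_theta_even)
    thus "8 dvd ?U $ i * (?V * ?W) $ l" by (cases "?U $ i = 0") auto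
  qed
  show "64 dvd SOME_bar n" if "n mod 8 = 7"
    unfolding SOME
  proof (rule dvd_fps_mult_nth)
    fix i l assume il: "i + l = n"
    have "4 * 8 dvd (?V * ?W) $ l" if "?U $ i \<noteq> 0"
    proof (rule dvd_fps_mult_nth)
      fix j k assume jk: "j + k = l"
      show "4 * 8 dvd ?V $ j * ?W $ k"
      proof (cases "?V $ j = 0 \<or> ?W $ k = 0")
        case False
        hence "even j" "4 dvd k" "j mod 8 \<noteq> 6" using V_even W_4 V_6 by blast+
        moreover have "i mod 8 \<in> {0, 1, 4}" using q_deriv_theta_nonzero that by blast
        ultimately have "j mod 4 = 2 \<and> k mod 8 = 4"
          using il jk \<open>n mod 8 = 7\<close> by (metis residues_mod_8_forced)
        thus ?thesis using V_dvd W_dvd by (intro mult_dvd_mono) auto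
      qed auto
    qed
    hence "?U $ i \<noteq> 0 \<Longrightarrow> 2 * (4 * 8) dvd ?U $ i * (?V * ?W) $ l"
      by (intro mult_dvd_mono q_deriv_theta_even)
    thus "64 dvd ?U $ i * (?V * ?W) $ l" by (cases "?U $ i = 0") auto
  qed
qed

theorem theorem8:
  fixes n :: nat
  shows "[SOME_bar (4 * n + 3) = 0] (mod 8) \<and> [SOME_bar (8 * n + 7) = 0] (mod 64)"
proof -
  have "(4 * n + 3) mod 4 = 3" "(8 * n + 7) mod 8 = 7" by presburger+
  thus ?thesis using SOME_bar_dvd by (simp add: cong_0_iff)
qed

end
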